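(* Let $\mathcal{J},\mathcal{K}\subset\mathbb{R}^n$ be convex sets such that $\mathcal{J}$ is compact and $\mathcal{J}\oplus\mathcal{K}$ is an affine free sum of convex sets intersecting at $p\in\mathbb{Q}^n$. Suppose further that $\operatorname{llenv}^p\operatorname{cone}\mathcal{J}=(\operatorname{lenv}^p\operatorname{cone}\mathcal{J})\cap\mathbb{Z}^{n+1}$. Then $$\sigma_{\operatorname{cone}(\mathcal{J}\oplus\mathcal{K})}(\mathbf{z})=(1-\mathbf{z}^{r\alpha(p)})\,\sigma_{\operatorname{cone}\mathcal{J}}(\mathbf{z})\,\sigma_{\operatorname{cone}\mathcal{K}}(\mathbf{z}),$$ where $r=\operatorname{den}(p)$.
   Context: $\mathcal{J}\oplus\mathcal{K}:=\operatorname{conv}(\mathcal{J}\cup\mathcal{K})$. $\alpha(a)=(a,1)\in\mathbb{R}^{n+1}$ for $a\in\mathbb{R}^n$; $\operatorname{cone}\mathcal{K}$ is the set of nonnegative multiples of elements of $\alpha(\mathcal{K})$; $\sigma_S(\mathbf{z})=\sum_{m\in S\cap\mathbb{Z}^{n+1}}\mathbf{z}^m$ with $\mathbf{z}^m=z_1^{m_1}\cdots z_{n+1}^{m_{n+1}}$, so $\mathbf{z}^{r\alpha(p)}=z_1^{rp_1}\cdots z_n^{rp_n}z_{n+1}^r$. $\operatorname{den}(p)$ is the lcm of the denominators of the coordinates of $p$. For $p\in\mathbb{Q}^n$, $\pi^p:\mathbb{R}^{n+1}\to\mathbb{R}^n$, $\pi^p(x)=\pi(x-x_{n+1}\alpha(p))$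 where $\pi$ drops the last coordinate; $\Lambda^p:=\pi^p(\mathbb{Z}^{n+1})$ (the lattice generated by $e_1,\dots,e_n,p$). Sublattices $L,M\subset\Lambda^p$ are complementary sublattices of $\Lambda^p$ if each element of $\operatorname{lin}(L\cup M)\cap\Lambda^p$ is the sum of a unique element of $L$ and a unique element of $M$. $\mathcal{J}\oplus\mathcal{K}$ is an affine free sum (intersecting at $p$) if $\mathcal{J}$ and $\mathcal{K}$ intersect at the point $p\in\mathbb{Q}^n$ and $\operatorname{lin}(\mathcal{J}-p)\cap\Lambda^p$ and $\operatorname{lin}(\mathcal{K}-p)\cap\Lambda^p$ are complementary sublattices of $\Lambda^p$. For a closed linear cone $\mathcal{C}$ not containing $-\alpha(p)$, $\epsilon^p_{\mathcal{C}}(x)=x-\max\{\lambda: x-\lambda\alpha(p)\in\mathcal{C}\}\alpha(p)$, $\operatorname{lenv}^p\mathcal{C}=\epsilon^p_{\mathcal{C}}(\mathcal{C})$, $\operatorname{llenv}^p\mathcal{C}=\epsilon^p_{\mathcal{C}}(\mathcal{C}\cap\mathbb{Z}^{n+1})$.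
   Formalization: Two assumptions are added, as the claim fails for irrational spans (p=0, J=[0,(1,√2)], K=[0,(1,√3)]): aff J ∩ aff K = {p}, and all points of Λ^p in lin((J∪K)−p) lie in the span of the two sublattices. Both are automatic if lin(J−p), lin(K−p) are spanned by points of Λ^p. *)

theory Defs
  imports "HOL-Analysis.Analysis"
begin

text \<open>The space \<open>\<real>\<^sup>n\<^sup>+\<^sup>1\<close> is modelled as \<open>(real ^ 'n) \<times> real\<close>; the second
  component is the last coordinate \<open>x\<^sub>n\<^sub>+\<^sub>1\<close>.\<close>

definition int_points :: "((real ^ 'n) \<times> real) set" where
  "int_points = {x. (\<forall>i. fst x $ i \<in> \<int>) \<and> snd x \<in> \<int>}"

definition alpha :: "real ^ 'n \<Rightarrow> (real ^ 'n) \<times> real" where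
  "alpha a = (a, 1)"

definition cone_over :: "(real ^ 'n) set \<Rightarrow> ((real ^ 'n) \<times> real) set" where
  "cone_over K = {c *\<^sub>R alpha a | c a. 0 \<le> c \<and> a \<in> K}"

definition free_sum :: "(real ^ 'n) set \<Rightarrow> (real ^ 'n) set \<Rightarrow> (real ^ 'n) set" where
  "free_sum J K = convex hull (J \<union> K)"

text \<open>\<open>quotient_of\<close> yields numerator and (positive) denominator in lowest terms; it is only
  meaningful here for points with rational coordinates.\<close>

definition den :: "real ^ 'n \<Rightarrow> int" where
  "den p = Lcm (range (\<lambda>i. snd (quotient_of (inv of_rat (p $ i)))))"

definition proj_along :: "real ^ 'n \<Rightarrow> (real ^ 'n) \<times> real \<Rightarrow> real ^ 'n" where
  "proj_along p x = fst (x - snd x *\<^sub>R alpha p)"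

definition Lambda :: "real ^ 'n \<Rightarrow> (real ^ 'n) set" where
  "Lambda p = proj_along p ` int_points"

definition sublattice :: "'a::ab_group_add set \<Rightarrow> 'a set \<Rightarrow> bool" where
  "sublattice L \<Lambda> \<longleftrightarrow> L \<subseteq> \<Lambda> \<and> 0 \<in> L \<and> (\<forall>x\<in>L. \<forall>y\<in>L. x - y \<in> L)"

definition complementary_sublattices ::
    "'a::real_vector set \<Rightarrow> 'a set \<Rightarrow> 'a set \<Rightarrow> bool" where
  "complementary_sublattices L M \<Lambda> \<longleftrightarrow>
     sublattice L \<Lambda> \<and> sublattice M \<Lambda> \<and>
     (\<forall>x \<in> span (L \<union> M) \<inter> \<Lambda>. \<exists>!(l, m). l \<in> L \<and> m \<in> M \<and> x = l + m)"

definition lin_at :: "'a::real_vector \<Rightarrow> 'a set \<Rightarrow> 'a set" where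
  "lin_at p S = span ((\<lambda>x. x - p) ` S)"

definition affine_free_sum_at ::
    "real ^ 'n \<Rightarrow> (real ^ 'n) set \<Rightarrow> (real ^ 'n) set \<Rightarrow> bool" where
  "affine_free_sum_at p J K \<longleftrightarrow>
     (\<forall>i. p $ i \<in> \<rat>) \<and> J \<inter> K = {p} \<and>
     complementary_sublattices (lin_at p J \<inter> Lambda p) (lin_at p K \<inter> Lambda p) (Lambda p)"

text \<open>Complementarity only constrains the lattice points of the two linear spans, so for spans
  that are not generated by lattice points it says little: for \<open>p = 0\<close> and segments from \<open>0\<close> to
  \<open>(1, sqrt 2)\<close> and from \<open>0\<close> to \<open>(1, sqrt 3)\<close> both sublattices are \<open>{0}\<close>, although the
  segments jointly span the plane.\<close>

text \<open>\<open>GREATEST\<close> is the maximum when it exists, which it does for \<open>x \<in> C\<close> when \<open>C\<close> is a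
  closed convex cone not containing \<open>- alpha p\<close>; it is unspecified otherwise.\<close>

definition env :: "real ^ 'n \<Rightarrow> ((real ^ 'n) \<times> real) set \<Rightarrow>
    (real ^ 'n) \<times> real \<Rightarrow> (real ^ 'n) \<times> real" where
  "env p C x = x - (GREATEST t. x - t *\<^sub>R alpha p \<in> C) *\<^sub>R alpha p"

definition lenv :: "real ^ 'n \<Rightarrow> ((real ^ 'n) \<times> real) set \<Rightarrow> ((real ^ 'n) \<times> real) set" where
  "lenv p C = env p C ` C"

definition llenv :: "real ^ 'n \<Rightarrow> ((real ^ 'n) \<times> real) set \<Rightarrow> ((real ^ 'n) \<times> real) set" where
  "llenv p C = env p C ` (C \<inter> int_points)"

text \<open>A formal series \<open>\<Sum>\<^sub>m f\<^sub>m z\<^sup>m\<close> is represented by its coefficient function \<open>f\<close>.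
  Exponents are kept in \<open>\<real>\<^sup>n\<^sup>+\<^sup>1\<close>; every series below is supported on \<open>int_points\<close>.
  No convergence is assumed: \<open>K\<close> may be unbounded, even contain a line.\<close>

type_synonym 'n series = "(real ^ 'n) \<times> real \<Rightarrow> int"

definition zpow :: "(real ^ 'n) \<times> real \<Rightarrow> 'n::finite series" where
  "zpow m = (\<lambda>k. of_bool (k = m))"

definition sigma_series :: "((real ^ 'n) \<times> real) set \<Rightarrow> 'n::finite series" where
  "sigma_series S = (\<lambda>m. of_bool (m \<in> S \<inter> int_points))"

text \<open>The product of two series with infinite supports makes sense only if each of its
  coefficients is a finite sum, which is what \<open>multipliable\<close> expresses.\<close>

definition multipliable :: "'n::finite series \<Rightarrow> 'n series \<Rightarrow> bool" where
  "multipliable f g \<longleftrightarrow> (\<forall>m. finite {(a, b). a + b = m \<and> f a \<noteq> 0 \<and> g b \<noteq> 0})"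

definition series_times :: "'n::finite series \<Rightarrow> 'n series \<Rightarrow> 'n series" (infixl \<open>\<odot>\<close> 70) where
  "f \<odot> g = (\<lambda>m. \<Sum>(a, b) | a + b = m \<and> f a \<noteq> 0 \<and> g b \<noteq> 0. f a * g b)"

end

theory Submission
  imports Defs
begin

text \<open>Write \<open>q\<close> for \<open>alpha p\<close> and \<open>r\<close> for \<open>den p\<close>. The product of \<open>1 - z\<^bsup>r q\<^esup>\<close> with the series of \<open>cone J\<close>
  is the series of the integer points \<open>a\<close> of \<open>cone J\<close> such that \<open>a - r q\<close> leaves \<open>cone J\<close>, and
  \<open>cone (J \<oplus> K) = cone J + cone K\<close>. The theorem thus says that every integer point of
  \<open>cone J + cone K\<close> is uniquely a sum \<open>a + b\<close> of such an \<open>a\<close> and an integer point \<open>b\<close> of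
  \<open>cone K\<close>. For uniqueness, the linear spans of the two cones meet in \<open>\<real> q\<close>, whose integer points
  are the multiples of \<open>r q\<close>. For existence, write the given point as \<open>x + y\<close> and push \<open>x\<close> along
  \<open>- q\<close> to the boundary of \<open>cone J\<close>: complementarity makes \<open>x\<close> congruent to an integer
  point modulo \<open>\<real> q\<close>, and the assumption on lower envelopes then makes the boundary point
  integral.\<close>

section \<open>Integer points and denominators\<close>

lemma int_points_add: "x \<in> int_points \<Longrightarrow> y \<in> int_points \<Longrightarrow> x + y \<in> int_points"
  by (auto simp: int_points_def)

lemma int_points_diff: "x \<in> int_points \<Longrightarrow> y \<in> int_points \<Longrightarrow> x - y \<in> int_points"
  by (auto simp: int_points_def)

text \<open>The coordinates of such a point are integers bounded by its norm, so the point lies in a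
  finite box.\<close>

lemma finite_int_points_bounded:
  fixes S :: "((real ^ 'n) \<times> real) set"
  assumes "bounded S"
  shows "finite (S \<inter> int_points)"
proof -
  obtain B where B: "\<And>x. x \<in> S \<Longrightarrow> norm x \<le> B"
    using assms by (auto simp: bounded_iff)
  define I where "I = {a \<in> \<int>. \<bar>a\<bar> \<le> B}"
  have I: "finite I"
    unfolding I_def by (rule finite_abs_int_segment)
  have "{v :: real ^ 'n. \<forall>i. v $ i \<in> I} \<subseteq> vec_lambda ` (UNIV \<rightarrow>\<^sub>E I)"
  proof
    fix v :: "real ^ 'n" assume "v \<in> {v. \<forall>i. v $ i \<in> I}"
    then show "v \<in> vec_lambda ` (UNIV \<rightarrow>\<^sub>E I)"
      by (intro image_eqI[of _ _ "vec_nth v"]) auto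
  qed
  then have "finite {v :: real ^ 'n. \<forall>i. v $ i \<in> I}"
    using I by (meson finite finite_PiE finite_imageI finite_subset)
  then have "finite ({v :: real ^ 'n. \<forall>i. v $ i \<in> I} \<times> I)"
    using I by simp
  moreover have "S \<inter> int_points \<subseteq> {v. \<forall>i. v $ i \<in> I} \<times> I"
  proof
    fix x assume x: "x \<in> S \<inter> int_points"
    obtain v t where vt: "x = (v, t)" by fastforce
    have "norm x \<le> B" using B x by auto
    then have "norm v \<le> B" "\<bar>t\<bar> \<le> B"
      using norm_fst_le[of v t] norm_snd_le[of t v] vt by auto
    moreover have "\<bar>v $ i\<bar> \<le> norm v" for i
      by (rule component_le_norm_cart)
    ultimately have "\<bar>v $ i\<bar> \<le> B" for i
      by (meson order_trans)
    then show "x \<in> {v. \<forall>i. v $ i \<in> I} \<times> I"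
      using x vt \<open>\<bar>t\<bar> \<le> B\<close> by (auto simp: I_def int_points_def)
  qed
  ultimately show ?thesis
    by (rule rev_finite_subset)
qed

text \<open>For \<open>x = a / b\<close> in lowest terms, \<open>t * x\<close> is integral exactly
  when \<open>b\<close> divides \<open>t * a\<close>, and coprimality cancels
  \<open>a\<close>.\<close>

lemma denominator_dvd_iff:
  fixes x :: real
  assumes "x \<in> \<rat>"
  shows "of_int t * x \<in> \<int> \<longleftrightarrow> snd (quotient_of (inv of_rat x)) dvd t"
proof -
  obtain y where y: "x = of_rat y"
    using assms by (auto elim: Rats_cases)
  obtain a b where ab: "quotient_of y = (a, b)" by fastforce
  have b: "b > 0" and cop: "coprime a b" and yab: "y = of_int a / of_int b"
    using quotient_of_denom_pos[OF ab] quotient_of_coprime[OF ab] quotient_of_div[OF ab] by auto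
  have inv: "inv of_rat x = y"
    unfolding y by (rule inv_f_f) (auto simp: inj_def)
  have xab: "x = of_int a / of_int b"
    unfolding y yab by (simp add: of_rat_divide)
  have "of_int t * x \<in> \<int> \<longleftrightarrow> b dvd t * a"
  proof
    assume "of_int t * x \<in> \<int>"
    then obtain k where "of_int t * x = of_int k" by (auto elim: Ints_cases)
    then have "real_of_int (t * a) = of_int (b * k)"
      using b by (simp add: xab field_simps)
    then show "b dvd t * a" by (metis dvd_triv_left of_int_eq_iff)
  next
    assume "b dvd t * a"
    then obtain k where "t * a = b * k" by auto
    then have "real_of_int t * of_int a = of_int b * of_int k" by (metis of_int_mult)
    then have "of_int t * x = of_int k"
      using b by (simp add: xab field_simps)
    then show "of_int t * x \<in> \<int>" by simp
  qed
  also have "\<dots> \<longleftrightarrow> b dvd t"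
    using cop by (simp add: coprime_dvd_mult_left_iff coprime_commute)
  finally show ?thesis by (simp add: inv ab)
qed

lemma den_pos: "den p > 0"
proof -
  have "den p \<noteq> 0"
    unfolding den_def
    by (subst Lcm_0_iff) (auto simp: image_iff, metis quotient_of_denom_pos' less_irrefl)
  moreover have "den p \<ge> 0"
    by (simp add: den_def)
  ultimately show ?thesis by simp
qed

text \<open>The last coordinate of \<open>alpha p\<close> is 1, which forces \<open>t\<close> to be
  an integer; the other coordinates then make every denominator of \<open>p\<close> divide
  it.\<close>

lemma multiple_alpha_int_points_iff:
  assumes "\<forall>i. p $ i \<in> \<rat>"
  shows "t *\<^sub>R alpha p \<in> int_points \<longleftrightarrow> (\<exists>k. t = of_int (k * den p))"
proof
  assume L: "t *\<^sub>R alpha p \<in> int_points"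
  then obtain j where j: "t = of_int j"
    by (auto simp: int_points_def alpha_def elim: Ints_cases)
  have "snd (quotient_of (inv of_rat (p $ i))) dvd j" for i
    using L assms by (simp add: denominator_dvd_iff[symmetric] int_points_def alpha_def j)
  then have "den p dvd j"
    unfolding den_def by (auto intro: Lcm_least)
  then show "\<exists>k. t = of_int (k * den p)"
    using j by (metis dvd_def mult.commute)
next
  assume "\<exists>k. t = of_int (k * den p)"
  then obtain k where k: "t = of_int (k * den p)" by auto
  have "snd (quotient_of (inv of_rat (p $ i))) dvd k * den p" for i
    unfolding den_def by (intro dvd_mult dvd_Lcm) auto
  then have "of_int (k * den p) * p $ i \<in> \<int>" for i
    using denominator_dvd_iff assms by blast
  then show "t *\<^sub>R alpha p \<in> int_points"
    unfolding k int_points_def alpha_def by auto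
qed

section \<open>Cones and projections\<close>

lemma cone_overE:
  assumes "x \<in> cone_over K"
  obtains c a where "x = c *\<^sub>R alpha a" "0 \<le> c" "a \<in> K"
  using assms unfolding cone_over_def by blast

lemma snd_cone_over_nonneg: "x \<in> cone_over K \<Longrightarrow> 0 \<le> snd x"
  by (auto simp: cone_over_def alpha_def)

lemma cone_over_scaleR: "x \<in> cone_over K \<Longrightarrow> 0 \<le> c \<Longrightarrow> c *\<^sub>R x \<in> cone_over K"
  unfolding cone_over_def by (force intro: mult_nonneg_nonneg)

lemma alpha_in_cone_over: "a \<in> K \<Longrightarrow> alpha a \<in> cone_over K"
  unfolding cone_over_def by (smt (verit) mem_Collect_eq scaleR_one)

lemma cone_over_mono: "J \<subseteq> K \<Longrightarrow> cone_over J \<subseteq> cone_over K"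
  by (auto simp: cone_over_def)

lemma cone_over_add:
  assumes "convex K" "x \<in> cone_over K" "y \<in> cone_over K"
  shows "x + y \<in> cone_over K"
proof -
  obtain c a where x: "x = c *\<^sub>R alpha a" "0 \<le> c" "a \<in> K"
    using assms by (elim cone_overE)
  obtain d b where y: "y = d *\<^sub>R alpha b" "0 \<le> d" "b \<in> K"
    using assms by (elim cone_overE)
  show ?thesis
  proof (cases "c + d = 0")
    case True
    then have "c = 0" "d = 0" using x y by auto
    then show ?thesis using assms x y by simp
  next
    case False
    then have pos: "c + d > 0" using x y by auto
    define e where "e = (c / (c + d)) *\<^sub>R a + (d / (c + d)) *\<^sub>R b"
    have "e \<in> K"
      unfolding e_def using pos x y
      by (intro convexD[OF assms(1)]) (simp_all flip: add_divide_distrib)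
    then have "(c + d) *\<^sub>R alpha e \<in> cone_over K"
      using pos by (intro cone_over_scaleR alpha_in_cone_over) auto
    moreover have "(c + d) *\<^sub>R alpha e = x + y"
      using False by (simp add: x y e_def alpha_def scaleR_add_right)
    ultimately show ?thesis by simp
  qed
qed

text \<open>A point of the hull is \<open>u *\<^sub>R a + v *\<^sub>R b\<close> with
  \<open>u + v = 1\<close>, and \<open>alpha\<close> respects such affine combinations. Both sets
  must be nonempty: an empty one would make the right-hand side empty.\<close>

lemma cone_over_free_sum:
  fixes J K :: "(real ^ 'n) set"
  assumes "convex J" "J \<noteq> {}" "convex K" "K \<noteq> {}"
  shows "cone_over (free_sum J K) = {x + y | x y. x \<in> cone_over J \<and> y \<in> cone_over K}"
proof (intro equalityI subsetI)
  fix z assume "z \<in> cone_over (free_sum J K)"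
  then obtain c u v a b where z: "z = c *\<^sub>R alpha (u *\<^sub>R a + v *\<^sub>R b)" "0 \<le> c" "0 \<le> u" "0 \<le> v"
      "u + v = 1" "a \<in> J" "b \<in> K"
    unfolding cone_over_def free_sum_def convex_hull_union_two[OF assms] by auto
  have "alpha (u *\<^sub>R a + v *\<^sub>R b) = u *\<^sub>R alpha a + v *\<^sub>R alpha b"
    using z by (simp add: alpha_def)
  then have "z = c *\<^sub>R u *\<^sub>R alpha a + c *\<^sub>R v *\<^sub>R alpha b"
    using z by (simp add: scaleR_add_right)
  then show "z \<in> {x + y | x y. x \<in> cone_over J \<and> y \<in> cone_over K}"
    using z by (blast intro: cone_over_scaleR alpha_in_cone_over)
next
  fix z assume "z \<in> {x + y | x y. x \<in> cone_over J \<and> y \<in> cone_over K}"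
  then obtain x y where z: "z = x + y" "x \<in> cone_over J" "y \<in> cone_over K" by auto
  have "J \<subseteq> free_sum J K" "K \<subseteq> free_sum J K"
    unfolding free_sum_def by (auto intro: hull_inc)
  then have "x \<in> cone_over (free_sum J K)" "y \<in> cone_over (free_sum J K)"
    using z cone_over_mono by blast+
  then show "z \<in> cone_over (free_sum J K)"
    unfolding z(1) by (intro cone_over_add) (simp_all add: free_sum_def)
qed

lemma closed_cone_over:
  assumes "compact K"
  shows "closed (cone_over K)"
proof -
  have "cone_over K = conic hull (alpha ` K)"
    unfolding cone_over_def conic_hull_explicit by blast
  moreover have "compact (alpha ` K)"
    unfolding alpha_def by (intro compact_continuous_image continuous_intros assms)
  moreover have "0 \<notin> alpha ` K"
    by (auto simp: alpha_def zero_prod_def)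
  ultimately show ?thesis
    by (metis closed_conic_hull)
qed

text \<open>In \<open>c *\<^sub>R alpha a\<close> the factor \<open>c\<close> is the height, so
  bounding the height bounds the factor.\<close>

lemma bounded_cone_over_slab:
  assumes "bounded K"
  shows "bounded {x \<in> cone_over K. snd x \<le> t}"
proof -
  obtain B where B: "\<And>a. a \<in> K \<Longrightarrow> norm a \<le> B"
    using assms by (auto simp: bounded_iff)
  have "norm x \<le> t * (B + 1)" if x: "x \<in> cone_over K" and t: "snd x \<le> t" for x
  proof -
    obtain c a where xc: "x = c *\<^sub>R alpha a" "0 \<le> c" "a \<in> K"
      using x by (elim cone_overE)
    have "norm (alpha a) \<le> norm a + 1"
      unfolding alpha_def using norm_Pair_le[of a "1::real"] by simp
    also have "\<dots> \<le> B + 1" using B xc by simp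
    finally have "norm (alpha a) \<le> B + 1" .
    moreover have "c \<le> t" using t xc by (simp add: alpha_def)
    ultimately show ?thesis
      using xc by (auto intro!: mult_mono)
  qed
  then show ?thesis unfolding bounded_iff by blast
qed

lemma linear_proj_along: "linear (proj_along p)"
  unfolding proj_along_def alpha_def by (intro linearI) (simp_all add: algebra_simps)

lemmas proj_along_add = linear_add[OF linear_proj_along]
lemmas proj_along_diff = linear_diff[OF linear_proj_along]

lemma proj_along_eq_0: "proj_along p x = 0 \<Longrightarrow> x = snd x *\<^sub>R alpha p"
  by (cases x) (simp add: proj_along_def alpha_def)

lemma proj_along_cone_over: "x \<in> cone_over K \<Longrightarrow> proj_along p x \<in> lin_at p K"
proof -
  assume "x \<in> cone_over K"
  then obtain c a where x: "x = c *\<^sub>R alpha a" "a \<in> K"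
    by (elim cone_overE)
  have "proj_along p x = c *\<^sub>R (a - p)"
    by (simp add: x proj_along_def alpha_def scaleR_diff_right)
  also have "\<dots> \<in> lin_at p K"
    unfolding lin_at_def using x by (intro span_scale span_base imageI)
  finally show ?thesis .
qed

text \<open>Since \<open>p\<close> lies in both sets, translation by \<open>- p\<close> turns each
  affine hull into the corresponding linear span.\<close>

lemma lin_at_Int_lin_at:
  assumes "p \<in> J" "p \<in> K" "affine hull J \<inter> affine hull K = {p}"
  shows "lin_at p J \<inter> lin_at p K = {0}"
proof -
  have "lin_at p J \<inter> lin_at p K = (\<lambda>x. x - p) ` (affine hull J \<inter> affine hull K)"
    unfolding lin_at_def
    by (simp add: diffs_affine_hull_span[OF assms(1), symmetric]
        diffs_affine_hull_span[OF assms(2), symmetric] image_Int inj_def)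
  then show ?thesis using assms(3) by simp
qed

lemma env_eqI:
  assumes "x - t *\<^sub>R alpha p \<in> C" "\<And>s. x - s *\<^sub>R alpha p \<in> C \<Longrightarrow> s \<le> t"
  shows "env p C x = x - t *\<^sub>R alpha p"
  using Greatest_equality[of "\<lambda>t. x - t *\<^sub>R alpha p \<in> C" t] assms by (simp add: env_def)

text \<open>The admissible shifts form a closed set containing 0. They are at most the height of
  \<open>x\<close>, because \<open>alpha p\<close> has height 1 and the cone has no point of
  negative height. So their supremum is attained.\<close>

lemma cone_over_max_shift:
  assumes "compact K" "x \<in> cone_over K"
  obtains t where "0 \<le> t" "x - t *\<^sub>R alpha p \<in> cone_over K"
    "\<And>s. x - s *\<^sub>R alpha p \<in> cone_over K \<Longrightarrow> s \<le> t"
proof -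
  define T where "T = {t. x - t *\<^sub>R alpha p \<in> cone_over K}"
  have bound: "t \<le> snd x" if "t \<in> T" for t
    using snd_cone_over_nonneg[of "x - t *\<^sub>R alpha p" K] that by (simp add: T_def alpha_def)
  have "closed T"
  proof -
    have "T = (\<lambda>t. x - t *\<^sub>R alpha p) -` cone_over K" by (auto simp: T_def)
    then show ?thesis
      using closed_cone_over[OF assms(1)] by (auto intro!: closed_vimage continuous_intros)
  qed
  moreover have "0 \<in> T" using assms by (simp add: T_def)
  moreover have "bdd_above T" using bound by (auto simp: bdd_above_def)
  ultimately have "Sup T \<in> T" "\<And>s. s \<in> T \<Longrightarrow> s \<le> Sup T"
    using closed_contains_Sup[of T] by (auto intro: cSup_upper)
  then show thesis
    using \<open>0 \<in> T\<close> by (intro that[of "Sup T"]) (auto simp: T_def)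
qed

section \<open>Series\<close>

lemma one_minus_zpow_times:
  assumes "v \<noteq> 0"
  shows "((zpow 0 - zpow v) \<odot> f) m = f m - f (m - v)"
proof -
  let ?g = "zpow 0 - zpow v"
  have "((zpow 0 - zpow v) \<odot> f) m = (\<Sum>(a, b) \<in> {(0, m), (v, m - v)}. ?g a * f b)"
    unfolding series_times_def
  \<comment> \<open>The index set is enlarged to both candidate pairs; a pair at which
    \<open>f\<close> vanishes contributes 0.\<close>
  proof (rule sum.mono_neutral_left)
    show "{(a, b). a + b = m \<and> ?g a \<noteq> 0 \<and> f b \<noteq> 0} \<subseteq> {(0, m), (v, m - v)}"
    proof
      fix z assume "z \<in> {(a, b). a + b = m \<and> ?g a \<noteq> 0 \<and> f b \<noteq> 0}"
      then obtain a b where z: "z = (a, b)" "a + b = m" "?g a \<noteq> 0"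
        by blast
      then have "b = m - a" "a = 0 \<or> a = v"
        by (auto simp: zpow_def simp del: split_paired_All)
      then show "z \<in> {(0, m), (v, m - v)}"
        using z(1) by auto
    qed
  qed auto
  also have "\<dots> = f m - f (m - v)"
    using assms by (simp add: zpow_def)
  finally show ?thesis .
qed

text \<open>If \<open>a + b = m\<close>, then \<open>b\<close> has nonnegative height, so
  \<open>a\<close> lies in the part of \<open>cone_over J\<close> no higher than \<open>m\<close>,
  which has finitely many integer points; \<open>a\<close> determines \<open>b\<close>.\<close>

lemma multipliable_sigma_cones:
  fixes J K :: "(real ^ 'n) set"
  assumes "bounded J"
  shows "multipliable (sigma_series (cone_over J)) (sigma_series (cone_over K))"
  unfolding multipliable_def
proof
  fix m :: "(real ^ 'n) \<times> real"
  let ?S = "{x \<in> cone_over J. snd x \<le> snd m} \<inter> int_points"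
  have "finite ?S"
    by (intro finite_int_points_bounded bounded_cone_over_slab assms)
  then have "finite ((\<lambda>a. (a, m - a)) ` ?S)" by simp
  moreover have "{(a, b). a + b = m \<and> sigma_series (cone_over J) a \<noteq> 0 \<and>
      sigma_series (cone_over K) b \<noteq> 0} \<subseteq> (\<lambda>a. (a, m - a)) ` ?S"
    using snd_cone_over_nonneg[of _ K] by (auto simp: sigma_series_def image_iff)
  ultimately show "finite {(a, b). a + b = m \<and> sigma_series (cone_over J) a \<noteq> 0 \<and>
      sigma_series (cone_over K) b \<noteq> 0}"
    by (rule rev_finite_subset)
qed

text \<open>The coefficient of the product at \<open>m\<close> counts the ways to write
  \<open>m = a + b\<close>; the assumptions make this count 1 on the integer points of
  \<open>C\<close> and 0 elsewhere.\<close>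

lemma sigma_series_times_unique:
  assumes "\<And>m. m \<in> C \<inter> int_points \<Longrightarrow> \<exists>a b. a \<in> A \<inter> int_points \<and> b \<in> B \<inter> int_points \<and> m = a + b"
    and "\<And>a b. a \<in> A \<inter> int_points \<Longrightarrow> b \<in> B \<inter> int_points \<Longrightarrow> a + b \<in> C"
    and "\<And>a b a' b'. a \<in> A \<inter> int_points \<Longrightarrow> b \<in> B \<inter> int_points \<Longrightarrow> a' \<in> A \<inter> int_points \<Longrightarrow>
      b' \<in> B \<inter> int_points \<Longrightarrow> a + b = a' + b' \<Longrightarrow> a = a'"
  shows "sigma_series A \<odot> sigma_series B = sigma_series C"
proof
  fix m
  let ?P = "{(a, b). a + b = m \<and> sigma_series A a \<noteq> 0 \<and> sigma_series B b \<noteq> 0}"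
  show "(sigma_series A \<odot> sigma_series B) m = sigma_series C m"
  proof (cases "m \<in> C \<inter> int_points")
    case True
    then obtain a b where ab: "a \<in> A \<inter> int_points" "b \<in> B \<inter> int_points" "m = a + b"
      using assms(1) by blast
    have "?P = {(a, b)}"
    proof (intro equalityI subsetI)
      fix z assume "z \<in> ?P"
      then obtain a' b' where z: "z = (a', b')" "a' \<in> A \<inter> int_points" "b' \<in> B \<inter> int_points" "a' + b' = a + b"
        using ab by (auto simp: sigma_series_def)
      then have "a' = a" using assms(3) ab by blast
      then show "z \<in> {(a, b)}" using z by simp
    qed (use ab in \<open>auto simp: sigma_series_def\<close>)
    then show ?thesis
      using True ab by (simp add: series_times_def sigma_series_def)
  next
    case False
    then have "?P = {}"
      using assms(2) int_points_add by (fastforce simp: sigma_series_def)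
    then have "(sigma_series A \<odot> sigma_series B) m = 0"
      unfolding series_times_def by (simp only: sum.empty)
    then show ?thesis
      using False by (simp add: sigma_series_def)
  qed
qed

text \<open>The coefficient at \<open>m\<close> is the indicator at \<open>m\<close> minus that at
  \<open>m - v\<close>. As adding \<open>v\<close> stays in the cone, the value -1 never
  occurs.\<close>

lemma one_minus_zpow_times_sigma_cone:
  assumes "convex K" "v \<in> cone_over K \<inter> int_points" "v \<noteq> 0"
  shows "(zpow 0 - zpow v) \<odot> sigma_series (cone_over K) =
    sigma_series {a \<in> cone_over K. a - v \<notin> cone_over K}"
proof
  fix m
  have "m - v \<in> cone_over K \<Longrightarrow> m \<in> cone_over K"
    using cone_over_add[OF assms(1), of "m - v" v] assms(2) by simp
  moreover have "m - v \<in> int_points \<longleftrightarrow> m \<in> int_points"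
    using int_points_add[of "m - v" v] int_points_diff[of m v] assms(2) by auto
  ultimately show "((zpow 0 - zpow v) \<odot> sigma_series (cone_over K)) m =
    sigma_series {a \<in> cone_over K. a - v \<notin> cone_over K} m"
    by (auto simp: one_minus_zpow_times[OF assms(3)] sigma_series_def)
qed

section \<open>Unique decomposition of integer points\<close>

lemma integer_decomposition_exists:
  fixes J K :: "(real ^ 'n) set"
  assumes "convex J" "convex K" "compact J"
    and free: "affine_free_sum_at p J K"
    and spans_meet: "affine hull J \<inter> affine hull K = {p}"
    and lattice_spans:
      "lin_at p (J \<union> K) \<inter> Lambda p \<subseteq> span ((lin_at p J \<inter> Lambda p) \<union> (lin_at p K \<inter> Lambda p))"
    and llenv: "llenv p (cone_over J) \<subseteq> int_points"
    and x: "x \<in> cone_over J" and y: "y \<in> cone_over K" and xy: "x + y \<in> int_points"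
    and d: "0 < d"
  shows "\<exists>a b. a \<in> {a \<in> cone_over J. a - d *\<^sub>R alpha p \<notin> cone_over J} \<inter> int_points \<and>
    b \<in> cone_over K \<inter> int_points \<and> x + y = a + b"
proof -
  have rat: "\<forall>i. p $ i \<in> \<rat>" and pJ: "p \<in> J" and pK: "p \<in> K"
    and comp: "complementary_sublattices (lin_at p J \<inter> Lambda p) (lin_at p K \<inter> Lambda p) (Lambda p)"
    using free by (auto simp: affine_free_sum_at_def)
  have projx: "proj_along p x \<in> lin_at p J" and projy: "proj_along p y \<in> lin_at p K"
    using x y by (auto intro: proj_along_cone_over)
  have "lin_at p J \<subseteq> lin_at p (J \<union> K)" "lin_at p K \<subseteq> lin_at p (J \<union> K)"
    unfolding lin_at_def by (intro span_mono image_mono Un_upper1 Un_upper2)+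
  then have "proj_along p (x + y) \<in> lin_at p (J \<union> K)"
    using projx projy unfolding proj_along_add lin_at_def by (meson span_add subsetD)
  moreover have "proj_along p (x + y) \<in> Lambda p"
    using xy by (auto simp: Lambda_def)
  \<comment> \<open>Here \<open>lattice_spans\<close> brings the point into the span on which
    complementarity speaks.\<close>
  ultimately have "proj_along p (x + y) \<in>
      span ((lin_at p J \<inter> Lambda p) \<union> (lin_at p K \<inter> Lambda p)) \<inter> Lambda p"
    using lattice_spans by blast
  then have "\<exists>!(l, k). l \<in> lin_at p J \<inter> Lambda p \<and> k \<in> lin_at p K \<inter> Lambda p \<and>
      proj_along p (x + y) = l + k"
    by (rule comp[unfolded complementary_sublattices_def, THEN conjunct2, THEN conjunct2, THEN bspec])
  then obtain z where z: "case z of (l, k) \<Rightarrow> l \<in> lin_at p J \<inter> Lambda p \<and>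
      k \<in> lin_at p K \<inter> Lambda p \<and> proj_along p (x + y) = l + k"
    by (rule ex1E)
  define l k where "l = fst z" and "k = snd z"
  have lk: "l \<in> lin_at p J \<inter> Lambda p" "k \<in> lin_at p K \<inter> Lambda p"
      "proj_along p (x + y) = l + k"
    using z by (simp_all add: l_def k_def split_def)
  from lk(1) obtain a0 where a0: "a0 \<in> int_points" "l = proj_along p a0"
    by (auto simp: Lambda_def)
  \<comment> \<open>The two sides lie in the two linear spans, which meet only in 0. So
    \<open>l\<close> is the projection of \<open>x\<close>, and \<open>x\<close> differs from the
    integer point \<open>a0\<close> by a multiple of \<open>alpha p\<close>.\<close>
  have "proj_along p x - l = k - proj_along p y"
    using lk(3) by (simp add: proj_along_add algebra_simps)
  moreover have "proj_along p x - l \<in> lin_at p J" "k - proj_along p y \<in> lin_at p K"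
    using lk projx projy by (auto simp: lin_at_def intro: span_diff)
  ultimately have "proj_along p x - l \<in> lin_at p J \<inter> lin_at p K"
    by simp
  then have "proj_along p (x - a0) = 0"
    unfolding lin_at_Int_lin_at[OF pJ pK spans_meet] proj_along_diff a0(2) by (rule singletonD)
  then obtain s where s: "x - a0 = s *\<^sub>R alpha p"
    using proj_along_eq_0 by blast
  obtain t where t: "0 \<le> t" "x - t *\<^sub>R alpha p \<in> cone_over J"
      "\<And>u. x - u *\<^sub>R alpha p \<in> cone_over J \<Longrightarrow> u \<le> t"
    using cone_over_max_shift[OF assms(3) x] by metis
  define e where "e = x - t *\<^sub>R alpha p"
  \<comment> \<open>The point \<open>a0\<close> may lie outside the cone. Adding a multiple
    \<open>w \<ge> s\<close> of \<open>den p\<close> times \<open>alpha p\<close> keeps it integral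
    and moves it to \<open>x\<close> plus a nonnegative multiple of \<open>alpha p\<close>.\<close>
  define N where "N = \<lceil>\<bar>s\<bar>\<rceil>"
  define w :: real where "w = of_int (N * den p)"
  have "w \<ge> s"
  proof -
    have "N \<ge> 0" by (simp add: N_def)
    have "s \<le> of_int N" unfolding N_def by linarith
    also have "of_int N \<le> w"
      unfolding w_def of_int_le_iff using den_pos[of p] \<open>N \<ge> 0\<close>
      by (simp add: mult_le_cancel_left1)
    finally show ?thesis .
  qed
  define x' where "x' = a0 + w *\<^sub>R alpha p"
  have x': "x' = x + (w - s) *\<^sub>R alpha p"
    using s by (simp add: x'_def algebra_simps)
  have "x' \<in> cone_over J"
    unfolding x' using \<open>w \<ge> s\<close> pJ
    by (intro cone_over_add x cone_over_scaleR alpha_in_cone_over assms(1)) auto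
  moreover have "w *\<^sub>R alpha p \<in> int_points"
    using multiple_alpha_int_points_iff[OF rat] w_def by blast
  then have "x' \<in> int_points"
    unfolding x'_def using a0 int_points_add by blast
  \<comment> \<open>On a line parallel to \<open>alpha p\<close> all cone points have the same
    envelope point, so \<open>e\<close> is also the envelope point of the integer point
    \<open>x'\<close> and belongs to \<open>llenv\<close>.\<close>
  moreover have "env p (cone_over J) x' = x' - (t + (w - s)) *\<^sub>R alpha p"
  proof (rule env_eqI)
    show "x' - (t + (w - s)) *\<^sub>R alpha p \<in> cone_over J"
      using t(2) by (simp add: x' algebra_simps)
    fix u assume "x' - u *\<^sub>R alpha p \<in> cone_over J"
    then have "x - (u - (w - s)) *\<^sub>R alpha p \<in> cone_over J"
      by (simp add: x' algebra_simps)
    then show "u \<le> t + (w - s)" using t(3) by fastforce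
  qed
  then have "env p (cone_over J) x' = e"
    by (simp add: x' e_def algebra_simps)
  ultimately have "e \<in> int_points"
    using llenv by (auto simp: llenv_def)
  moreover have "e - d *\<^sub>R alpha p \<notin> cone_over J"
  proof
    assume "e - d *\<^sub>R alpha p \<in> cone_over J"
    then have "x - (t + d) *\<^sub>R alpha p \<in> cone_over J"
      by (simp add: e_def algebra_simps)
    then show False using t(3) d by fastforce
  qed
  \<comment> \<open>What is removed from \<open>x\<close> is given to \<open>y\<close>;
    \<open>0 \<le> t\<close> and \<open>p \<in> K\<close> keep the result in the cone.\<close>
  moreover have "y + t *\<^sub>R alpha p \<in> cone_over K"
    using y t(1) pK by (intro cone_over_add cone_over_scaleR alpha_in_cone_over assms(2)) auto
  moreover have eq: "x + y = e + (y + t *\<^sub>R alpha p)"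
    by (simp add: e_def)
  moreover have "y + t *\<^sub>R alpha p \<in> int_points"
    using int_points_diff[OF xy \<open>e \<in> int_points\<close>] unfolding eq by simp
  ultimately show ?thesis
    using t(2) unfolding e_def by blast
qed

text \<open>The difference \<open>a - a' = b' - b\<close> projects into both linear spans, hence to
  0, so it is \<open>k * den p\<close> times \<open>alpha p\<close> for some integer
  \<open>k\<close>. If \<open>k\<close> were nonzero, the larger of \<open>a\<close> and
  \<open>a'\<close> would stay in the cone after losing one period \<open>den p\<close>.\<close>

lemma integer_decomposition_unique:
  fixes J K :: "(real ^ 'n) set"
  assumes "convex J" "\<forall>i. p $ i \<in> \<rat>" "p \<in> J" "p \<in> K"
    and spans_meet: "affine hull J \<inter> affine hull K = {p}"
    and a: "a \<in> {a \<in> cone_over J. a - of_int (den p) *\<^sub>R alpha p \<notin> cone_over J} \<inter> int_points"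
    and a': "a' \<in> {a \<in> cone_over J. a - of_int (den p) *\<^sub>R alpha p \<notin> cone_over J} \<inter> int_points"
    and b: "b \<in> cone_over K" and b': "b' \<in> cone_over K"
    and eq: "a + b = a' + b'"
  shows "a = a'"
proof -
  have "proj_along p (a - a') \<in> lin_at p J"
    using a a' proj_along_cone_over[of a J p] proj_along_cone_over[of a' J p]
    unfolding proj_along_diff by (auto simp: lin_at_def intro: span_diff)
  moreover have "proj_along p (b' - b) \<in> lin_at p K"
    using proj_along_cone_over[OF b, of p] proj_along_cone_over[OF b', of p]
    unfolding proj_along_diff by (auto simp: lin_at_def intro: span_diff)
  moreover have "a - a' = b' - b"
    using eq by (simp add: algebra_simps)
  ultimately have "proj_along p (a - a') = 0"
    using lin_at_Int_lin_at[OF assms(3,4) spans_meet] by auto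
  then obtain t where t: "a - a' = t *\<^sub>R alpha p"
    using proj_along_eq_0 by blast
  have "a - a' \<in> int_points"
    using a a' int_points_diff by blast
  then obtain k where k: "t = of_int (k * den p)"
    unfolding t multiple_alpha_int_points_iff[OF assms(2)] by blast
  have no_shift: "\<not> 1 \<le> j"
    if c: "c - of_int (den p) *\<^sub>R alpha p \<notin> cone_over J" "c' \<in> cone_over J"
      "c - c' = of_int (j * den p) *\<^sub>R alpha p" for c c' j
  proof
    assume "1 \<le> j"
    \<comment> \<open>Subtracting one period from \<open>c\<close> leaves \<open>c'\<close> plus
      \<open>j - 1\<close> periods, a nonnegative number.\<close>
    then have "0 \<le> (of_int ((j - 1) * den p) :: real)"
      using den_pos[of p] by simp
    then have "c' + of_int ((j - 1) * den p) *\<^sub>R alpha p \<in> cone_over J"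
      using c assms by (intro cone_over_add cone_over_scaleR alpha_in_cone_over)
    moreover have "c = c' + of_int (j * den p) *\<^sub>R alpha p"
      using c(3) by (simp add: algebra_simps)
    ultimately show False
      using c(1) by (simp add: algebra_simps)
  qed
  have "a' - a = of_int (- k * den p) *\<^sub>R alpha p"
    using t k by (simp add: algebra_simps)
  then have "\<not> 1 \<le> k" "\<not> 1 \<le> - k"
    using no_shift[of a a' k] no_shift[of a' a "- k"] a a' t k by auto
  then have "k = 0" by linarith
  then show ?thesis using t k by simp
qed

text \<open>\<open>spans_meet\<close> makes the sum of the real spans direct, and
  \<open>lattice_spans\<close> makes complementarity reach all lattice points of the joint span. The
  latter excludes \<open>p = 0\<close> with the segments from 0 to \<open>(1, sqrt 2)\<close> and to
  \<open>(1, sqrt 3)\<close>: there \<open>(2, 3, 2)\<close> lies in the cone over the free sum,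
  while the integer points of both cones are multiples of \<open>(0, 0, 1)\<close>. Multipliability
  is asserted separately because a sum over an infinite index set has the default value 0.\<close>

theorem theorem5p4:
  fixes J K :: "(real ^ 'n) set" and p :: "real ^ 'n"
  assumes "convex J" and "convex K" and "compact J"
    and "affine_free_sum_at p J K"
    and spans_meet: "affine hull J \<inter> affine hull K = {p}"
    and lattice_spans:
      "lin_at p (J \<union> K) \<inter> Lambda p \<subseteq> span ((lin_at p J \<inter> Lambda p) \<union> (lin_at p K \<inter> Lambda p))"
    and "llenv p (cone_over J) = lenv p (cone_over J) \<inter> int_points"
  shows "multipliable (sigma_series (cone_over J)) (sigma_series (cone_over K)) \<and>
    sigma_series (cone_over (free_sum J K)) =
      (zpow 0 - zpow (of_int (den p) *\<^sub>R alpha p)) \<odot> sigma_series (cone_over J) \<odot> sigma_series (cone_over K)"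
proof
  show "multipliable (sigma_series (cone_over J)) (sigma_series (cone_over K))"
    using assms(3) by (intro multipliable_sigma_cones compact_imp_bounded)
next
  have rat: "\<forall>i. p $ i \<in> \<rat>" and pJ: "p \<in> J" and pK: "p \<in> K"
    using assms(4) by (auto simp: affine_free_sum_at_def)
  let ?v = "of_int (den p) *\<^sub>R alpha p"
  let ?D = "{a \<in> cone_over J. a - ?v \<notin> cone_over J}"
  have r: "0 < (of_int (den p) :: real)"
    using den_pos by simp
  have "?v \<in> int_points"
    unfolding multiple_alpha_int_points_iff[OF rat] by (metis mult_1)
  moreover have "?v \<in> cone_over J"
    using r pJ by (intro cone_over_scaleR alpha_in_cone_over) auto
  moreover have "?v \<noteq> 0"
    using r by (simp add: alpha_def zero_prod_def)
  ultimately have "(zpow 0 - zpow ?v) \<odot> sigma_series (cone_over J) = sigma_series ?D"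
    using one_minus_zpow_times_sigma_cone[OF assms(1)] by blast
  \<comment> \<open>\<open>\<odot>\<close> associates to the left, so the remaining product has
    \<open>?D\<close> as its first support, a subset of \<open>cone_over J\<close>.\<close>
  moreover have "sigma_series ?D \<odot> sigma_series (cone_over K) = sigma_series (cone_over (free_sum J K))"
  proof (rule sigma_series_times_unique)
    have sum: "cone_over (free_sum J K) = {x + y | x y. x \<in> cone_over J \<and> y \<in> cone_over K}"
      using assms(1,2) pJ pK by (intro cone_over_free_sum) auto
    have ll: "llenv p (cone_over J) \<subseteq> int_points"
      using assms(7) by simp
    show "\<exists>a b. a \<in> ?D \<inter> int_points \<and> b \<in> cone_over K \<inter> int_points \<and> m = a + b"
      if "m \<in> cone_over (free_sum J K) \<inter> int_points" for m
      using that integer_decomposition_exists[OF assms(1-6) ll _ _ _ r] unfolding sum by blast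
    show "a + b \<in> cone_over (free_sum J K)"
      if "a \<in> ?D \<inter> int_points" "b \<in> cone_over K \<inter> int_points" for a b
      using that unfolding sum by blast
    show "a = a'"
      if "a \<in> ?D \<inter> int_points" "b \<in> cone_over K \<inter> int_points" "a' \<in> ?D \<inter> int_points"
        "b' \<in> cone_over K \<inter> int_points" "a + b = a' + b'" for a b a' b'
      using integer_decomposition_unique[OF assms(1) rat pJ pK spans_meet that(1,3) _ _ that(5)] that(2,4)
      by blast
  qed
  ultimately show "sigma_series (cone_over (free_sum J K)) =
      (zpow 0 - zpow ?v) \<odot> sigma_series (cone_over J) \<odot> sigma_series (cone_over K)"
    by simp
qed

end
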